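(* Let $G,H$ be countable commutative semigroups, let $p\in\beta G$ be an idempotent ultrafilter, and let $\Gamma$ be a set of functions from $H$ to $G$ which is an R-family with respect to $p$ and which is licit. Then for any finite set $F\subset\Gamma$, any $A\in p$ and any IP-set $(y_\alpha)_{\alpha\in\mathcal{F}}$ in $H$, there exist a sub-IP-set $(z_\beta)_{\beta\in\mathcal{F}}$ of $(y_\alpha)_{\alpha\in\mathcal{F}}$ and an IP-set $(x_\beta)_{\beta\in\mathcal{F}}$ in $G$ such that $$\forall f\in F\qquad\forall\beta\in\mathcal{F}\qquad x_\beta+f(z_\beta)\in A.$$
   Context: $\mathbb{N}=\{1,2,\dots\}$ and $\mathcal{F}$ is the family of non-empty finite subsets of $\mathbb{N}$; $\alpha<\beta$ means $\max\alpha<\min\beta$. Semigroups are written additively. An IP-set in a commutative semigroup $S$ is a family $(x_\alpha)_{\alpha\in\mathcal{F}}$ of elements of $S$ with $x_{\alpha\cup\beta}=x_\alpha+x_\beta$ for all disjoint $\alpha,\beta\in\mathcal F$; equivalently $x_\alpha=\sum_{n\in\alpha}x_n$, where $x_n=x_{\{n\}}$. $(x_\alpha)$ is a sub-IP-set of $(y_\alpha)$ if there are $\alpha_1<\alpha_2<\cdots$ in $\mathcal{F}$ with $x_n=y_{\alpha_n}$ for all $n\in\mathbb{N}$. $\beta G$ is the set of ultrafilters on $G$ with the operation $p+q=\{A\subset G:\{g\in G:A-g\in p\}\in q\}$, where $A-g=\{h\in G:h+g\in A\}$; $p$ is idempotent if $p+p=p$. R-family: a set $\Gamma$ of functions $H\to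 G$ is an R-family with respect to $p\in\beta G$ if for every finite set $F\subset\Gamma$, every $A\in p$ and every IP-set $(y_\alpha)_{\alpha\in\mathcal{F}}$ in $H$, there exist $x\in G$ and $\alpha\in\mathcal{F}$ such that $x+f(y_\alpha)\in A$ for all $f\in F$. Licit: a set $\Gamma$ of functions $H\to G$ is licit if for any $f\in\Gamma$ and any $z\in H$ there exists a function $\phi_z\in\Gamma$ such that $f(y+z)=\phi_z(y)+f(z)$ for all $y\in H$. *)

theory Defs
  imports Complex_Main "HOL-Library.Countable"
begin

text \<open>
  The natural numbers of the source start at 1, so index sets range over the
  non-empty finite sets of \<^emph>\<open>positive\<close> naturals.
\<close>

definition fin_sets :: "nat set set" where
  "fin_sets = {\<alpha>. \<alpha> \<subseteq> {1..} \<and> finite \<alpha> \<and> \<alpha> \<noteq> {}}"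

definition block_less :: "nat set \<Rightarrow> nat set \<Rightarrow> bool" where
  "block_less \<alpha> \<beta> \<longleftrightarrow> Max \<alpha> < Min \<beta>"

text \<open>
  A family indexed by \<^const>\<open>fin_sets\<close> is a total function on \<^typ>\<open>nat set\<close>;
  its values outside \<^const>\<open>fin_sets\<close> are irrelevant.
\<close>

definition IP_set :: "(nat set \<Rightarrow> 'a::ab_semigroup_add) \<Rightarrow> bool" where
  "IP_set x \<longleftrightarrow>
     (\<forall>\<alpha>\<in>fin_sets. \<forall>\<beta>\<in>fin_sets. \<alpha> \<inter> \<beta> = {} \<longrightarrow> x (\<alpha> \<union> \<beta>) = x \<alpha> + x \<beta>)"

definition sub_IP_set ::
    "(nat set \<Rightarrow> 'a::ab_semigroup_add) \<Rightarrow> (nat set \<Rightarrow> 'a) \<Rightarrow> bool" where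
  "sub_IP_set x y \<longleftrightarrow> IP_set x \<and> IP_set y \<and>
     (\<exists>a :: nat \<Rightarrow> nat set.
        (\<forall>n\<ge>1. a n \<in> fin_sets) \<and>
        (\<forall>m\<ge>1. \<forall>n>m. block_less (a m) (a n)) \<and>
        (\<forall>n\<ge>1. x {n} = y (a n)))"

text \<open>
  An ultrafilter is a proper filter deciding every predicate. For \<open>p\<close> of type
  \<^typ>\<open>'a filter\<close>, membership of the set \<open>A\<close> in \<open>p\<close> reads
  \<open>eventually (\<lambda>x. x \<in> A) p\<close>.
\<close>

definition is_ultrafilter :: "'a filter \<Rightarrow> bool" where
  "is_ultrafilter p \<longleftrightarrow>
     p \<noteq> bot \<and> (\<forall>P. eventually P p \<or> eventually (\<lambda>x. \<not> P x) p)"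

text \<open>
  \<open>A\<close> belongs to the sum of \<open>p\<close> and \<open>q\<close> iff \<open>{g. A - g \<in> p} \<in> q\<close>, where
  \<open>A - g = {h. h + g \<in> A}\<close>; see \<open>mem_filter_add\<close> below.
\<close>

definition filter_add ::
    "'a::ab_semigroup_add filter \<Rightarrow> 'a filter \<Rightarrow> 'a filter" where
  "filter_add p q = Abs_filter (\<lambda>P. \<forall>\<^sub>F g in q. \<forall>\<^sub>F h in p. P (h + g))"

lemma eventually_filter_add:
  "eventually P (filter_add p q) \<longleftrightarrow> (\<forall>\<^sub>F g in q. \<forall>\<^sub>F h in p. P (h + g))"
  unfolding filter_add_def
proof (rule eventually_Abs_filter, rule is_filter.intro)
  show "\<forall>\<^sub>F g in q. \<forall>\<^sub>F h in p. P (h + g) \<and> Q (h + g)"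
    if "\<forall>\<^sub>F g in q. \<forall>\<^sub>F h in p. P (h + g)" "\<forall>\<^sub>F g in q. \<forall>\<^sub>F h in p. Q (h + g)" for P Q
    using that by (simp add: eventually_conj_iff)
  show "\<forall>\<^sub>F g in q. \<forall>\<^sub>F h in p. Q (h + g)"
    if "\<forall>x. P x \<longrightarrow> Q x" "\<forall>\<^sub>F g in q. \<forall>\<^sub>F h in p. P (h + g)" for P Q
    using that(2) by (rule eventually_mono) (use that(1) in \<open>auto elim: eventually_mono\<close>)
qed simp

lemma mem_filter_add:
  "eventually (\<lambda>x. x \<in> A) (filter_add p q) \<longleftrightarrow>
     eventually (\<lambda>g. g \<in> {g. eventually (\<lambda>h. h \<in> {h. h + g \<in> A}) p}) q"
  by (simp add: eventually_filter_add)

lemma is_ultrafilter_filter_add: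
  assumes p: "is_ultrafilter p" and q: "is_ultrafilter q"
  shows "is_ultrafilter (filter_add p q)"
  unfolding is_ultrafilter_def
proof (intro conjI allI)
  show "filter_add p q \<noteq> bot"
    using p q by (simp add: is_ultrafilter_def trivial_limit_def eventually_filter_add)
  fix P
  have *: "eventually (\<lambda>h. \<not> R h) p \<longleftrightarrow> \<not> eventually R p" for R
    using p eventually_conj[of R p "\<lambda>h. \<not> R h"]
    by (auto simp: is_ultrafilter_def trivial_limit_def)
  show "eventually P (filter_add p q) \<or> eventually (\<lambda>x. \<not> P x) (filter_add p q)"
    using q by (simp add: is_ultrafilter_def eventually_filter_add *)
qed

definition idempotent_filter :: "'a::ab_semigroup_add filter \<Rightarrow> bool" where
  "idempotent_filter p \<longleftrightarrow> filter_add p p = p"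

definition R_family ::
    "('h::ab_semigroup_add \<Rightarrow> 'g::ab_semigroup_add) set \<Rightarrow> 'g filter \<Rightarrow> bool" where
  "R_family \<Gamma> p \<longleftrightarrow>
     (\<forall>F A y. F \<subseteq> \<Gamma> \<longrightarrow> finite F \<longrightarrow> eventually (\<lambda>x. x \<in> A) p \<longrightarrow> IP_set y \<longrightarrow>
        (\<exists>x. \<exists>\<alpha>\<in>fin_sets. \<forall>f\<in>F. x + f (y \<alpha>) \<in> A))"

definition licit ::
    "('h::ab_semigroup_add \<Rightarrow> 'g::ab_semigroup_add) set \<Rightarrow> bool" where
  "licit \<Gamma> \<longleftrightarrow> (\<forall>f\<in>\<Gamma>. \<forall>z. \<exists>\<phi>\<in>\<Gamma>. \<forall>y. f (y + z) = \<phi> y + f z)"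

end

theory Submission
  imports Defs
begin

text \<open>
  For \<open>A\<close> in the idempotent \<open>p\<close>, the set of all \<open>a \<in> A\<close> with
  \<open>A - a \<in> p\<close> is again in \<open>p\<close>, and its translates by its own elements
  are in \<open>p\<close> as well. The blocks and the generators \<open>x\<^sub>n\<close> are chosen recursively such that
  all partial sums \<open>x\<^sub>\<beta> + f (z\<^sub>\<beta>)\<close> stay in this set. At each step licitness rewrites
  \<open>f (y\<^sub>\<alpha> + z\<^sub>\<beta>)\<close> as \<open>\<phi> (y\<^sub>\<alpha>) + f (z\<^sub>\<beta>)\<close>, so that the finitely many
  conditions on the next pair all have the form \<open>x + g (y\<^sub>\<alpha>) \<in> B\<close> with \<open>B \<in> p\<close>
  and \<open>g \<in> \<Gamma>\<close>; the R-family property, applied to a tail of the IP-set, supplies it.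
\<close>

section \<open>Star sets of an idempotent filter\<close>

definition star :: "'a::ab_semigroup_add filter \<Rightarrow> 'a set \<Rightarrow> 'a set" where
  "star p A = {a \<in> A. \<forall>\<^sub>F h in p. h + a \<in> A}"

text \<open>Idempotency puts \<open>A\<close> into \<open>p + p\<close>, so \<open>A - g\<close>
  lies in \<open>p\<close> for \<open>p\<close>-almost all \<open>g\<close>; intersecting with
  \<open>A\<close> gives the star set.\<close>

lemma eventually_star:
  assumes "idempotent_filter p" and A: "\<forall>\<^sub>F x in p. x \<in> A"
  shows "\<forall>\<^sub>F x in p. x \<in> star p A"
proof -
  have "eventually (\<lambda>x. x \<in> A) (filter_add p p)"
    using assms by (simp add: idempotent_filter_def)
  then have "\<forall>\<^sub>F g in p. \<forall>\<^sub>F h in p. h + g \<in> A"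
    by (simp add: eventually_filter_add)
  with A show ?thesis
    by (auto simp: star_def eventually_conj_iff)
qed

text \<open>For \<open>a\<close> in \<open>star p A\<close> the set \<open>A - a\<close> is in
  \<open>p\<close>, hence so is its star set, and by associativity that star set is contained in
  \<open>star p A - a\<close>.\<close>

lemma eventually_translate_star:
  assumes "idempotent_filter p" and a: "a \<in> star p A"
  shows "\<forall>\<^sub>F h in p. h + a \<in> star p A"
proof -
  have "\<forall>\<^sub>F h in p. h \<in> {h. h + a \<in> A}"
    using a by (simp add: star_def)
  from eventually_star[OF assms(1) this] show ?thesis
    by (rule eventually_mono) (simp add: star_def add.assoc)
qed

section \<open>IP-sets generated by sequences\<close>

text \<open>A semigroup has no empty sum; \<^const>\<open>None\<close> plays its role in the fold.\<close>

definition IP_gen :: "(nat \<Rightarrow> 'a::ab_semigroup_add) \<Rightarrow> nat set \<Rightarrow> 'a" where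
  "IP_gen x \<beta> =
     the (Finite_Set.fold (\<lambda>n s. Some (case s of None \<Rightarrow> x n | Some a \<Rightarrow> x n + a)) None \<beta>)"

lemma comp_fun_commute_option_add:
  fixes x :: "nat \<Rightarrow> 'a::ab_semigroup_add"
  shows "comp_fun_commute (\<lambda>n s. Some (case s of None \<Rightarrow> x n | Some a \<Rightarrow> x n + a))"
  by standard (auto simp: fun_eq_iff ac_simps split: option.split)

lemma IP_gen_singleton [simp]: "IP_gen x {n} = x n"
  by (simp add: IP_gen_def comp_fun_commute_on.fold_insert[OF
        comp_fun_commute_option_add[unfolded comp_fun_commute_def']])

lemma IP_gen_insert:
  assumes "finite \<beta>" "\<beta> \<noteq> {}" "n \<notin> \<beta>"
  shows "IP_gen x (insert n \<beta>) = x n + IP_gen x \<beta>"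
proof -
  interpret comp_fun_commute "\<lambda>n s. Some (case s of None \<Rightarrow> x n | Some a \<Rightarrow> x n + a)"
    by (rule comp_fun_commute_option_add)
  \<comment> \<open>Exhibiting an element of \<open>\<beta>\<close> shows that the fold over
    \<open>\<beta>\<close> is a \<open>Some\<close>, so inserting \<open>n\<close> takes the adding
    branch.\<close>
  obtain m \<gamma> where "\<beta> = insert m \<gamma>" "m \<notin> \<gamma>"
    using assms(2) by (meson ex_in_conv mk_disjoint_insert)
  with assms show ?thesis
    by (simp add: IP_gen_def)
qed

lemma IP_set_IP_gen: "IP_set (IP_gen x)"
  unfolding IP_set_def
proof (intro ballI impI)
  fix \<alpha> \<beta> assume "\<alpha> \<in> fin_sets" and \<beta>: "\<beta> \<in> fin_sets" and disj: "\<alpha> \<inter> \<beta> = {}"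
  then have "finite \<alpha>" "\<alpha> \<noteq> {}" "finite \<beta>" "\<beta> \<noteq> {}" by (auto simp: fin_sets_def)
  from this(1,2) disj show "IP_gen x (\<alpha> \<union> \<beta>) = IP_gen x \<alpha> + IP_gen x \<beta>"
  proof (induction \<alpha> rule: finite_ne_induct)
    case (singleton n)
    with \<open>finite \<beta>\<close> \<open>\<beta> \<noteq> {}\<close> show ?case by (simp add: IP_gen_insert)
  next
    case (insert n \<alpha>)
    with \<open>finite \<beta>\<close> have "IP_gen x (insert n (\<alpha> \<union> \<beta>)) = x n + IP_gen x (\<alpha> \<union> \<beta>)"
      by (intro IP_gen_insert) auto
    with insert show ?case by (simp add: IP_gen_insert ac_simps)
  qed
qed

section \<open>Ordered blocks and their unions\<close>

lemma block_less_disjoint: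
  assumes "block_less \<alpha> \<beta>" "finite \<alpha>" "finite \<beta>"
  shows "\<alpha> \<inter> \<beta> = {}"
proof (rule ccontr)
  assume "\<alpha> \<inter> \<beta> \<noteq> {}"
  then obtain n where "n \<in> \<alpha>" "n \<in> \<beta>" by blast
  then have "n \<le> Max \<alpha>" "Min \<beta> \<le> n" using assms by auto
  with assms(1) show False by (simp add: block_less_def)
qed

lemma block_less_trans:
  assumes "block_less \<alpha> \<beta>" "block_less \<beta> \<gamma>" "\<beta> \<in> fin_sets"
  shows "block_less \<alpha> \<gamma>"
proof -
  have "Min \<beta> \<le> Max \<beta>"
    using assms(3) by (auto simp: fin_sets_def)
  with assms(1,2) show ?thesis by (simp add: block_less_def)
qed

text \<open>Ordered blocks are pairwise disjoint, so disjoint index sets have disjoint unions of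
  blocks.\<close>

lemma IP_set_Union_blocks:
  assumes y: "IP_set y"
    and a: "\<And>n. n \<ge> 1 \<Longrightarrow> a n \<in> fin_sets"
    and less: "\<And>m n. m \<ge> 1 \<Longrightarrow> m < n \<Longrightarrow> block_less (a m) (a n)"
  shows "IP_set (\<lambda>\<beta>. y (\<Union>n\<in>\<beta>. a n))"
  unfolding IP_set_def
proof (intro ballI impI)
  have fin: "(\<Union>n\<in>\<beta>. a n) \<in> fin_sets" if "\<beta> \<in> fin_sets" for \<beta>
    using that a by (fastforce simp: fin_sets_def)
  have fin_a: "finite (a n)" if "n \<ge> 1" for n
    using a[OF that] by (simp add: fin_sets_def)
  have dis: "a m \<inter> a n = {}" if "m \<ge> 1" "n \<ge> 1" "m \<noteq> n" for m n
  proof (cases "m < n")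
    case True
    with that(1,2) show ?thesis
      by (intro block_less_disjoint less fin_a)
  next
    case False
    with that(3) have "n < m" by simp
    with that(1,2) have "a n \<inter> a m = {}"
      by (intro block_less_disjoint less fin_a)
    then show ?thesis by blast
  qed
  fix \<alpha> \<beta> :: "nat set" assume ab: "\<alpha> \<in> fin_sets" "\<beta> \<in> fin_sets" "\<alpha> \<inter> \<beta> = {}"
  have "a m \<inter> a n = {}" if "m \<in> \<alpha>" "n \<in> \<beta>" for m n
    using that ab by (intro dis) (auto simp: fin_sets_def)
  then have "(\<Union>n\<in>\<alpha>. a n) \<inter> (\<Union>n\<in>\<beta>. a n) = {}" by blast
  with y fin[OF ab(1)] fin[OF ab(2)]
  show "y (\<Union>n\<in>\<alpha> \<union> \<beta>. a n) = y (\<Union>n\<in>\<alpha>. a n) + y (\<Union>n\<in>\<beta>. a n)"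
    by (simp add: IP_set_def UN_Un)
qed

section \<open>Extending the construction by one generator\<close>

text \<open>The R-family property does not control where \<open>\<alpha>\<close> lies, so it is
  applied to \<open>y\<close> with all indices shifted by \<open>m\<close>.\<close>

lemma R_family_tail:
  assumes R: "R_family \<Gamma> p" and F: "F \<subseteq> \<Gamma>" "finite F"
    and A: "\<forall>\<^sub>F x in p. x \<in> A" and y: "IP_set y"
  obtains x \<alpha> where "\<alpha> \<in> fin_sets" "m < Min \<alpha>" "\<And>f. f \<in> F \<Longrightarrow> x + f (y \<alpha>) \<in> A"
proof -
  have fin: "(+) m ` \<alpha> \<in> fin_sets" if "\<alpha> \<in> fin_sets" for \<alpha>
    using that by (auto simp: fin_sets_def)
  have "IP_set (\<lambda>\<alpha>. y ((+) m ` \<alpha>))"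
    unfolding IP_set_def
  proof (intro ballI impI)
    fix \<alpha> \<beta> :: "nat set" assume ab: "\<alpha> \<in> fin_sets" "\<beta> \<in> fin_sets" "\<alpha> \<inter> \<beta> = {}"
    then have "(+) m ` \<alpha> \<inter> (+) m ` \<beta> = {}" by auto
    with y fin[OF ab(1)] fin[OF ab(2)]
    show "y ((+) m ` (\<alpha> \<union> \<beta>)) = y ((+) m ` \<alpha>) + y ((+) m ` \<beta>)"
      by (simp add: IP_set_def image_Un)
  qed
  with R F A obtain x \<alpha> where \<alpha>: "\<alpha> \<in> fin_sets" "\<forall>f\<in>F. x + f (y ((+) m ` \<alpha>)) \<in> A"
    unfolding R_family_def by meson
  \<comment> \<open>The inequality is strict because indices are at least 1.\<close>
  have "m < Min ((+) m ` \<alpha>)"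
    using \<alpha>(1) by (subst Min_gr_iff) (auto simp: fin_sets_def)
  with \<alpha> fin that show thesis by blast
qed

text \<open>
  \<open>D\<close> collects the pairs \<open>(x\<^sub>\<beta>, z\<^sub>\<beta>)\<close> of all partial sums constructed so far.
\<close>

lemma licit_R_family_extend:
  fixes p :: "'g::ab_semigroup_add filter"
    and F :: "('h::ab_semigroup_add \<Rightarrow> 'g) set"
  assumes idem: "idempotent_filter p" and R: "R_family \<Gamma> p" and lic: "licit \<Gamma>"
    and F: "F \<subseteq> \<Gamma>" "finite F" and A: "\<forall>\<^sub>F x in p. x \<in> A" and y: "IP_set y"
    and D: "finite D" "\<forall>(a, b)\<in>D. \<forall>f\<in>F. a + f b \<in> star p A"
  obtains x \<alpha> where "\<alpha> \<in> fin_sets" "m < Min \<alpha>"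
    "\<And>f. f \<in> F \<Longrightarrow> x + f (y \<alpha>) \<in> star p A"
    "\<And>a b f. (a, b) \<in> D \<Longrightarrow> f \<in> F \<Longrightarrow> (x + a) + f (y \<alpha> + b) \<in> star p A"
proof -
  have "\<forall>f\<in>\<Gamma>. \<forall>z. \<exists>\<phi>. \<phi> \<in> \<Gamma> \<and> (\<forall>y. f (y + z) = \<phi> y + f z)"
    using lic unfolding licit_def by blast
  then obtain \<phi> where \<phi>: "\<And>f z. f \<in> \<Gamma> \<Longrightarrow> \<phi> f z \<in> \<Gamma>"
    "\<And>f z y. f \<in> \<Gamma> \<Longrightarrow> f (y + z) = \<phi> f z y + f z"
    by metis
  \<comment> \<open>\<open>F\<close> serves the new pair on its own; the functions
    \<open>\<phi> f b\<close> serve its sums with the old pairs.\<close>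
  define F' where "F' = F \<union> (\<lambda>(f, a, b). \<phi> f b) ` (F \<times> D)"
  \<comment> \<open>All conditions are imposed on every function in \<open>F'\<close> at once, so a
    single use of the R-family property suffices. \<open>B\<close> is in \<open>p\<close> as a
    finite intersection of sets in \<open>p\<close>.\<close>
  define B where
    "B = {h. h \<in> star p A \<and> (\<forall>(f, a, b)\<in>F \<times> D. h + (a + f b) \<in> star p A)}"
  have "\<forall>\<^sub>F h in p. \<forall>(f, a, b)\<in>F \<times> D. h + (a + f b) \<in> star p A"
    using F(2) D eventually_translate_star[OF idem]
    by (intro eventually_ball_finite) auto
  then have B: "\<forall>\<^sub>F h in p. h \<in> B"
    using eventually_star[OF idem A] by (simp add: B_def eventually_conj_iff)
  have F': "F' \<subseteq> \<Gamma>" "finite F'"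
    using F D(1) \<phi>(1) by (auto simp: F'_def)
  obtain x \<alpha> where x: "\<alpha> \<in> fin_sets" "m < Min \<alpha>" "\<And>f. f \<in> F' \<Longrightarrow> x + f (y \<alpha>) \<in> B"
    using R_family_tail[OF R F' B y] by blast
  show thesis
  proof (rule that[OF x(1,2)])
    show "x + f (y \<alpha>) \<in> star p A" if "f \<in> F" for f
      using x(3)[of f] that by (simp add: F'_def B_def)
    show "(x + a) + f (y \<alpha> + b) \<in> star p A" if ab: "(a, b) \<in> D" and f: "f \<in> F" for a b f
    proof -
      have "\<phi> f b \<in> F'"
        using ab f by (force simp: F'_def)
      then have "(x + \<phi> f b (y \<alpha>)) + (a + f b) \<in> star p A"
        using x(3)[of "\<phi> f b"] ab f by (force simp: B_def)
      moreover have "f (y \<alpha> + b) = \<phi> f b (y \<alpha>) + f b"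
        using \<phi>(2) f F(1) by blast
      ultimately show ?thesis by (simp add: ac_simps)
    qed
  qed
qed

theorem theorem4p10:
  fixes p :: "'g::{ab_semigroup_add, countable} filter"
    and \<Gamma> F :: "('h::{ab_semigroup_add, countable} \<Rightarrow> 'g) set"
    and A :: "'g set"
    and y :: "nat set \<Rightarrow> 'h"
  assumes "is_ultrafilter p"
    and "idempotent_filter p"
    and "R_family \<Gamma> p"
    and "licit \<Gamma>"
    and "F \<subseteq> \<Gamma>"
    and "finite F"
    and "eventually (\<lambda>x. x \<in> A) p"
    and "IP_set y"
  shows "\<exists>z x. sub_IP_set z y \<and> IP_set x \<and>
           (\<forall>f\<in>F. \<forall>\<beta>\<in>fin_sets. x \<beta> + f (z \<beta>) \<in> A)"
proof -
  \<comment> \<open>Values are kept in the star set and not merely in \<open>A\<close>, since only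
    then are the translates needed at the next stage in \<open>p\<close>.\<close>
  define good :: "('g \<times> 'h) set \<Rightarrow> bool" where
    "good D \<longleftrightarrow> finite D \<and> (\<forall>(a, b)\<in>D. \<forall>f\<in>F. a + f b \<in> star p A)" for D
  define next_sums :: "'g \<Rightarrow> nat set \<Rightarrow> ('g \<times> 'h) set \<Rightarrow> ('g \<times> 'h) set" where
    "next_sums x \<alpha> D = insert (x, y \<alpha>) (D \<union> (\<lambda>(a, b). (x + a, y \<alpha> + b)) ` D)" for x \<alpha> D
  \<comment> \<open>A state holds the latest generator, its block and all partial sums so
    far.\<close>
  have "\<exists>s :: nat \<Rightarrow> 'g \<times> nat set \<times> ('g \<times> 'h) set. \<forall>n.
      (case s n of (x, \<alpha>, D) \<Rightarrow> \<alpha> \<in> fin_sets \<and> good D) \<and>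
      (case s n of (x, \<alpha>, D) \<Rightarrow> case s (Suc n) of (x', \<alpha>', D') \<Rightarrow>
         block_less \<alpha> \<alpha>' \<and> D' = next_sums x' \<alpha>' D)"
  proof (rule dependent_nat_choice)
    show "\<exists>s :: 'g \<times> nat set \<times> ('g \<times> 'h) set.
        case s of (x, \<alpha>, D) \<Rightarrow> \<alpha> \<in> fin_sets \<and> good D"
      \<comment> \<open>Index sets are positive, so stage 0 may carry any generator and block; the
        empty collection of sums is good vacuously.\<close>
      by (rule exI[of _ "(undefined, {1}, {})"]) (simp add: fin_sets_def good_def)
    fix s :: "'g \<times> nat set \<times> ('g \<times> 'h) set" and n :: nat
    assume s: "case s of (x, \<alpha>, D) \<Rightarrow> \<alpha> \<in> fin_sets \<and> good D"
    obtain x \<alpha> D where s_eq: "s = (x, \<alpha>, D)" by (cases s)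
    from s have D: "finite D" "\<forall>(a, b)\<in>D. \<forall>f\<in>F. a + f b \<in> star p A"
      by (auto simp: s_eq good_def)
    \<comment> \<open>Taking \<open>m\<close> to be \<open>Max \<alpha>\<close> places the new block
      beyond the current one.\<close>
    obtain x' \<alpha>' where *: "\<alpha>' \<in> fin_sets" "Max \<alpha> < Min \<alpha>'"
      "\<And>f. f \<in> F \<Longrightarrow> x' + f (y \<alpha>') \<in> star p A"
      "\<And>a b f. (a, b) \<in> D \<Longrightarrow> f \<in> F \<Longrightarrow> (x' + a) + f (y \<alpha>' + b) \<in> star p A"
      using licit_R_family_extend[where D = D and m = "Max \<alpha>", OF assms(2-8) D] by metis
    have "good (next_sums x' \<alpha>' D)"
      using D * by (auto simp: good_def next_sums_def)
    with * show "\<exists>s'. (case s' of (x, \<alpha>, D) \<Rightarrow> \<alpha> \<in> fin_sets \<and> good D) \<and>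
        (case s of (x, \<alpha>, D) \<Rightarrow> case s' of (x', \<alpha>', D') \<Rightarrow>
           block_less \<alpha> \<alpha>' \<and> D' = next_sums x' \<alpha>' D)"
      by (intro exI[of _ "(x', \<alpha>', next_sums x' \<alpha>' D)"]) (simp add: s_eq block_less_def)
  qed
  then obtain s :: "nat \<Rightarrow> 'g \<times> nat set \<times> ('g \<times> 'h) set" where s: "\<And>n.
      (case s n of (x, \<alpha>, D) \<Rightarrow> \<alpha> \<in> fin_sets \<and> good D) \<and>
      (case s n of (x, \<alpha>, D) \<Rightarrow> case s (Suc n) of (x', \<alpha>', D') \<Rightarrow>
         block_less \<alpha> \<alpha>' \<and> D' = next_sums x' \<alpha>' D)"
    by blast
  define u a D where "u n = fst (s n)" and "a n = fst (snd (s n))" and "D n = snd (snd (s n))" for n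
  have a: "a n \<in> fin_sets" and good: "good (D n)" for n
    using s[of n] by (auto simp: a_def D_def split: prod.splits)
  have step: "block_less (a n) (a (Suc n))" and
    D_Suc: "D (Suc n) = next_sums (u (Suc n)) (a (Suc n)) (D n)" for n
    using s[of n] by (auto simp: u_def a_def D_def split: prod.splits)
  have less: "block_less (a m) (a n)" if "m < n" for m n
    using that by (induction rule: strict_inc_induct) (auto intro: step block_less_trans a)
  define x where "x = IP_gen u"
  define z where "z \<beta> = y (\<Union>n\<in>\<beta>. a n)" for \<beta>
  have IP_x: "IP_set x" unfolding x_def by (rule IP_set_IP_gen)
  have IP_z: "IP_set z"
    unfolding z_def using IP_set_Union_blocks[OF assms(8) a less] by simp
  \<comment> \<open>Stage 0 is vacuous. Afterwards the three kinds of pairs in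
    \<open>next_sums\<close> match \<open>Suc n\<close> being absent from \<open>\<beta>\<close>,
    alone in it, or joined by smaller indices.\<close>
  have sums: "(x \<beta>, z \<beta>) \<in> D n" if "\<beta> \<in> fin_sets" "\<beta> \<subseteq> {..n}" for \<beta> n
    using that
  proof (induction n arbitrary: \<beta>)
    case 0
    then show ?case by (fastforce simp: fin_sets_def)
  next
    case (Suc n)
    define \<gamma> where "\<gamma> = \<beta> - {Suc n}"
    have \<gamma>: "\<gamma> \<subseteq> {..n}" using Suc.prems by (auto simp: \<gamma>_def le_Suc_eq)
    have single: "x {Suc n} = u (Suc n)" "z {Suc n} = y (a (Suc n))"
      by (simp_all add: x_def z_def)
    consider "Suc n \<notin> \<beta>" | "\<beta> = {Suc n}" | "Suc n \<in> \<beta>" "\<gamma> \<noteq> {}"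
      by (auto simp: \<gamma>_def)
    then show ?case
    proof cases
      case 1
      then have "(x \<beta>, z \<beta>) \<in> D n"
        using Suc \<gamma> by (simp add: \<gamma>_def)
      then show ?thesis by (simp add: D_Suc next_sums_def)
    next
      case 2
      then show ?thesis by (simp add: single D_Suc next_sums_def)
    next
      case 3
      then have fin: "\<gamma> \<in> fin_sets" "{Suc n} \<in> fin_sets" "{Suc n} \<inter> \<gamma> = {}"
        and \<beta>: "\<beta> = {Suc n} \<union> \<gamma>"
        using Suc.prems by (auto simp: fin_sets_def \<gamma>_def)
      have "x \<beta> = u (Suc n) + x \<gamma>" "z \<beta> = y (a (Suc n)) + z \<gamma>"
        using IP_x IP_z fin unfolding \<beta> IP_set_def by (metis single)+
      then show ?thesis
        using Suc.IH[OF fin(1) \<gamma>] by (force simp: D_Suc next_sums_def)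
    qed
  qed
  have "x \<beta> + f (z \<beta>) \<in> A" if "f \<in> F" "\<beta> \<in> fin_sets" for f \<beta>
  proof -
    \<comment> \<open>Every sum is thus present at stage \<open>Max \<beta>\<close>, whose values
      lie in \<open>star p A\<close>, a subset of \<open>A\<close>.\<close>
    have "\<beta> \<subseteq> {..Max \<beta>}" using that(2) by (auto simp: fin_sets_def)
    from sums[OF that(2) this] good[of "Max \<beta>"] that(1) show ?thesis
      by (auto simp: good_def star_def)
  qed
  moreover have "sub_IP_set z y"
    unfolding sub_IP_set_def using IP_z assms(8) a less
    by (auto intro!: exI[of _ a] simp: z_def)
  ultimately show ?thesis using IP_x by blast
qed

end
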